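(* Let $G$ be a finite F-group with $\left|\frac{G}{Z(G)}\right| = p^k$, where $p$ is a prime. Then $G$ has exactly $\frac{p^k-1}{p-1}+1$ $z$-classes if and only if both of the following hold: (1) $\frac{G}{Z(G)}$ is elementary abelian; (2) $Z(x)=\langle x, Z(G)\rangle$ for all $x\in G\setminus Z(G)$.
   Context: For a group $G$, $Z(G)$ is its center, $C(x)$ is the centralizer in $G$ of $x\in G$, and, for $x \in G\setminus Z(G)$, $Z(x)$ denotes the center of the subgroup $C(x)$. A finite group $G$ is an F-group if for every $x,y\in G\setminus Z(G)$, $C(x)\le C(y)$ implies $C(x)=C(y)$. Two elements $x,y\in G$ are in the same $z$-class if their centralizers are conjugate in $G$, i.e. $C(x)=gC(y)g^{-1}$ for some $g\in G$; this is an equivalence relation on $G$ whose classes are the $z$-classes. *)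

theory Defs
  imports "HOL-Algebra.Multiplicative_Group" "HOL-Computational_Algebra.Primes"
begin

definition center :: "('a, 'b) monoid_scheme \<Rightarrow> 'a set" where
  "center G = {z \<in> carrier G. \<forall>g \<in> carrier G. z \<otimes>\<^bsub>G\<^esub> g = g \<otimes>\<^bsub>G\<^esub> z}"

definition centralizer :: "('a, 'b) monoid_scheme \<Rightarrow> 'a \<Rightarrow> 'a set" where
  "centralizer G x = {g \<in> carrier G. g \<otimes>\<^bsub>G\<^esub> x = x \<otimes>\<^bsub>G\<^esub> g}"

(* The group Z(x), the center of C(x) regarded as a group in its own right. *)
definition centralizer_center :: "('a, 'b) monoid_scheme \<Rightarrow> 'a \<Rightarrow> 'a set" where
  "centralizer_center G x = center (G\<lparr>carrier := centralizer G x\<rparr>)"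

definition F_group :: "('a, 'b) monoid_scheme \<Rightarrow> bool" where
  "F_group G \<longleftrightarrow> group G \<and> finite (carrier G) \<and>
     (\<forall>x \<in> carrier G - center G. \<forall>y \<in> carrier G - center G.
        centralizer G x \<subseteq> centralizer G y \<longrightarrow> centralizer G x = centralizer G y)"

definition z_rel :: "('a, 'b) monoid_scheme \<Rightarrow> ('a \<times> 'a) set" where
  "z_rel G = {(x, y). x \<in> carrier G \<and> y \<in> carrier G \<and>
     (\<exists>g \<in> carrier G. centralizer G x = (g <#\<^bsub>G\<^esub> centralizer G y) #>\<^bsub>G\<^esub> inv\<^bsub>G\<^esub> g)}"

definition z_classes :: "('a, 'b) monoid_scheme \<Rightarrow> 'a set set" where
  "z_classes G = carrier G // z_rel G"

(* The prime is part of the existential; the trivial group is elementary abelian. *)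
definition elementary_abelian :: "('a, 'b) monoid_scheme \<Rightarrow> bool" where
  "elementary_abelian G \<longleftrightarrow> comm_group G \<and>
     (\<exists>q::nat. prime q \<and> (\<forall>x \<in> carrier G - {\<one>\<^bsub>G\<^esub>}. group.ord G x = q))"

lemma (in group) subgroup_center: "subgroup (center G) G"
proof (rule subgroupI)
  show "center G \<subseteq> carrier G" by (auto simp: center_def)
  show "center G \<noteq> {}" by (auto simp: center_def intro!: exI[of _ \<one>])
next
  fix a assume a: "a \<in> center G"
  have "inv a \<otimes> g = g \<otimes> inv a" if g: "g \<in> carrier G" for g
  proof -
    have ac: "a \<in> carrier G" and "a \<otimes> inv g = inv g \<otimes> a"
      using a g by (auto simp: center_def)
    then have "inv (inv g \<otimes> a) = inv (a \<otimes> inv g)" by simp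
    then show ?thesis using ac g by (simp only: inv_mult_group inv_closed inv_inv)
  qed
  then show "inv a \<in> center G" using a by (simp add: center_def)
next
  fix a b assume ab: "a \<in> center G" "b \<in> center G"
  then have c: "a \<in> carrier G" "b \<in> carrier G" by (auto simp: center_def)
  have "(a \<otimes> b) \<otimes> g = g \<otimes> (a \<otimes> b)" if g: "g \<in> carrier G" for g
  proof -
    have "(a \<otimes> b) \<otimes> g = a \<otimes> (b \<otimes> g)" using c g by (rule m_assoc)
    also have "b \<otimes> g = g \<otimes> b" using ab g by (auto simp: center_def)
    also have "a \<otimes> (g \<otimes> b) = (a \<otimes> g) \<otimes> b" using c g by (simp only: m_assoc)
    also have "a \<otimes> g = g \<otimes> a" using ab g by (auto simp: center_def)
    also have "(g \<otimes> a) \<otimes> b = g \<otimes> (a \<otimes> b)" using c g by (simp only: m_assoc)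
    finally show ?thesis .
  qed
  then show "a \<otimes> b \<in> center G" using c by (simp add: center_def)
qed

lemma (in group) normal_center: "center G \<lhd> G"
  by (rule normalI[OF subgroup_center])
    (auto simp: center_def r_coset_def l_coset_def)

lemma (in group) equiv_z_rel: "equiv (carrier G) (z_rel G)"
proof (rule equivI)
  have sub: "centralizer G x \<subseteq> carrier G" for x by (auto simp: centralizer_def)
  have conj_eq: "(g <# ((h <# H) #> inv h)) #> inv g = ((g \<otimes> h) <# H) #> inv (g \<otimes> h)"
    if "g \<in> carrier G" "h \<in> carrier G" "H \<subseteq> carrier G" for g h H
  proof -
    have "g <# ((h <# H) #> inv h) = ((g \<otimes> h) <# H) #> inv h"
      using that coset_assoc[of g "inv h" "h <# H"]
      by (simp add: lcos_m_assoc l_coset_subset_G)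
    then show ?thesis
      using that by (simp add: coset_mult_assoc inv_mult_group l_coset_subset_G)
  qed
  have conj_one: "(\<one> <# H) #> inv \<one> = H" if "H \<subseteq> carrier G" for H
    using that by (simp add: lcos_mult_one)
  show "z_rel G \<subseteq> carrier G \<times> carrier G" by (auto simp: z_rel_def)
  show "refl_on (carrier G) (z_rel G)"
  proof (rule refl_onI)
    fix x assume "x \<in> carrier G"
    then show "(x, x) \<in> z_rel G"
      unfolding z_rel_def using conj_one[OF sub] by (auto intro!: bexI[of _ \<one>])
  qed
  show "sym (z_rel G)"
  proof (rule symI)
    fix x y assume "(x, y) \<in> z_rel G"
    then obtain g where xy: "x \<in> carrier G" "y \<in> carrier G" and g: "g \<in> carrier G"
      and eq: "centralizer G x = (g <# centralizer G y) #> inv g" by (auto simp: z_rel_def)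
    have "centralizer G y = (inv g <# centralizer G x) #> inv (inv g)"
      unfolding eq using conj_eq[of "inv g" g "centralizer G y"] conj_one[OF sub] g sub by simp
    then show "(y, x) \<in> z_rel G"
      unfolding z_rel_def using xy inv_closed[OF g] by blast
  qed
  show "trans (z_rel G)"
  proof (rule transI)
    fix x y z assume "(x, y) \<in> z_rel G" "(y, z) \<in> z_rel G"
    then obtain g h where "x \<in> carrier G" "z \<in> carrier G"
      and gh: "g \<in> carrier G" "h \<in> carrier G"
      and "centralizer G x = (g <# centralizer G y) #> inv g"
      and "centralizer G y = (h <# centralizer G z) #> inv h"
      by (auto simp: z_rel_def)
    moreover from this have "centralizer G x = ((g \<otimes> h) <# centralizer G z) #> inv (g \<otimes> h)"
      by (simp only: conj_eq[OF gh sub])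
    ultimately show "(x, z) \<in> z_rel G"
      by (simp add: z_rel_def) (use m_closed[OF gh] in blast)
  qed
qed

end

theory Submission
  imports Defs
begin

text \<open>Write $Z = Z(G)$ and $N = |Z|$, so that $|G| = p^k N$. In an F-group the elements with the same
  centralizer as a noncentral $x$ are exactly those of $Z(x) \setminus Z$
  (\<open>centralizer_center_diff_center\<close>). Since $Z(x)$ is a subgroup properly containing $Z$, its order
  is $N$ times a nontrivial power of $p$, so this set has at least $(p-1)N$ elements. Equal
  centralizers are conjugate, hence every noncentral $z$-class has at least $(p-1)N$ elements. The
  central elements form one $z$-class, and the other classes share the $(p^k-1)N$ noncentral elements.
  So there are at most $(p^k-1)/(p-1) + 1$ classes, and that number is reached exactly when every
  noncentral $z$-class has $(p-1)N$ elements (\<open>card_z_classes_eq_iff\<close>). It remains to compare this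
  minimality with conditions (1) and (2).

  If all noncentral classes are minimal, then the class of $x$ is $Z(x) \setminus Z$ and
  $|Z(x)| = pN$. There is no room between $Z$ and $Z(x)$, which gives (2). Moreover all conjugates of
  $x$ lie in $Z(x)$, so a commutator $[x,y]$ lies in $Z(x) \cap Z(y)$. By the F-property this
  intersection is $Z$ unless $C(x) = C(y)$, and in that case $x$ and $y$ commute. Hence $G/Z$ is abelian,
  and it has exponent $p$ because $Z$ has index $p$ in each $Z(x)$.

  Conversely, if $G/Z$ is abelian then a conjugate of $x$ differs from $x$ by a central factor and has
  the same centralizer, so the $z$-class of $x$ is $Z(x) \setminus Z$. With (2) and exponent $p$,
  $Z(x) = \langle x, Z\rangle$ has order $pN$, so the class is minimal.\<close>

section \<open>Counting blocks of minimal size\<close>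

lemma card_eq_iff_blocks_minimal:
  fixes P :: "'a set set" and b m :: nat
  assumes disj: "pairwise disjnt P" and fin: "finite (\<Union>P)"
    and ge: "\<And>S. S \<in> P \<Longrightarrow> b \<le> card S"
    and total: "card (\<Union>P) = b * m" and "0 < b"
  shows "card P = m \<longleftrightarrow> (\<forall>S\<in>P. card S = b)"
proof -
  have finP: "finite P" using fin by (rule finite_UnionD)
  have "sum card P = b * m"
    using card_Union_disjoint[OF disj] total fin by (metis finite_subset Union_upper)
  moreover have "(\<Sum>S\<in>P. card S - b) = sum card P - b * card P"
    using ge by (simp add: sum_subtractf_nat mult.commute)
  moreover have "b * card P \<le> sum card P"
    using sum_bounded_below[of P b card] ge by (simp add: mult.commute)
  ultimately have "card P = m \<longleftrightarrow> (\<Sum>S\<in>P. card S - b) = 0"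
    using \<open>0 < b\<close> by (metis diff_self_eq_0 diff_is_0_eq le_antisym mult_le_cancel1)
  also have "\<dots> \<longleftrightarrow> (\<forall>S\<in>P. card S \<le> b)" using finP by simp
  also have "\<dots> \<longleftrightarrow> (\<forall>S\<in>P. card S = b)" using ge by (auto intro: le_antisym)
  finally show ?thesis .
qed

section \<open>Centralizers and their centers\<close>

context group
begin

lemma cancel_inv:
  assumes "x \<in> carrier G" "y \<in> carrier G"
  shows "inv x \<otimes> (x \<otimes> y) = y" and "x \<otimes> (inv x \<otimes> y) = y"
  using assms by (simp_all add: m_assoc[symmetric])

lemma mem_center_iff: "z \<in> center G \<longleftrightarrow> z \<in> carrier G \<and> centralizer G z = carrier G"
  unfolding center_def centralizer_def by (auto intro: sym)

lemma center_subset: "center G \<subseteq> carrier G"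
  by (auto simp: center_def)

lemma center_comm:
  assumes "z \<in> center G" "g \<in> carrier G"
  shows "z \<otimes> g = g \<otimes> z"
  using assms unfolding center_def by blast

lemma subgroup_centralizer:
  assumes x: "x \<in> carrier G"
  shows "subgroup (centralizer G x) G"
proof (rule subgroupI)
  show "centralizer G x \<subseteq> carrier G" by (auto simp: centralizer_def)
  show "centralizer G x \<noteq> {}" using x by (auto simp: centralizer_def)
next
  fix a assume "a \<in> centralizer G x"
  then have a: "a \<in> carrier G" and eq: "a \<otimes> x = x \<otimes> a" by (auto simp: centralizer_def)
  have "inv a \<otimes> x = inv a \<otimes> (x \<otimes> a) \<otimes> inv a" using a x by (simp add: m_assoc)
  also have "inv a \<otimes> (x \<otimes> a) = x" using a x by (simp add: eq[symmetric] cancel_inv)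
  finally show "inv a \<in> centralizer G x" using a by (simp add: centralizer_def)
next
  fix a b assume "a \<in> centralizer G x" "b \<in> centralizer G x"
  then have ab: "a \<in> carrier G" "b \<in> carrier G" "a \<otimes> x = x \<otimes> a" "b \<otimes> x = x \<otimes> b"
    by (auto simp: centralizer_def)
  have "a \<otimes> b \<otimes> x = a \<otimes> x \<otimes> b" using ab(1,2,4) x by (simp add: m_assoc)
  also have "\<dots> = x \<otimes> (a \<otimes> b)" using ab(1-3) x by (simp add: m_assoc)
  finally show "a \<otimes> b \<in> centralizer G x" using ab by (simp add: centralizer_def)
qed

text \<open>An element commuting with all of $C(x)$ commutes with $x$ in particular, so it lies in $C(x)$ and hence
  in $Z(x)$.\<close>

lemma centralizer_center_eq:
  assumes "x \<in> carrier G"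
  shows "centralizer_center G x = {y \<in> carrier G. centralizer G x \<subseteq> centralizer G y}"
proof (intro equalityI subsetI)
  fix y assume "y \<in> centralizer_center G x"
  then have y: "y \<in> carrier G" and "\<And>g. g \<in> centralizer G x \<Longrightarrow> y \<otimes> g = g \<otimes> y"
    by (simp_all add: centralizer_center_def center_def) (simp add: centralizer_def)
  then have "centralizer G x \<subseteq> centralizer G y"
    unfolding centralizer_def by (blast intro: sym)
  then show "y \<in> {y \<in> carrier G. centralizer G x \<subseteq> centralizer G y}" using y by simp
next
  fix y assume "y \<in> {y \<in> carrier G. centralizer G x \<subseteq> centralizer G y}"
  then have y: "y \<in> carrier G" and sub: "centralizer G x \<subseteq> centralizer G y" by auto
  have comm: "y \<otimes> g = g \<otimes> y" if "g \<in> centralizer G x" for g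
    using subsetD[OF sub that] by (simp add: centralizer_def)
  moreover have "x \<in> centralizer G x" using assms by (simp add: centralizer_def)
  ultimately have "y \<in> centralizer G x" using y by (simp add: centralizer_def)
  then show "y \<in> centralizer_center G x"
    using comm by (simp add: centralizer_center_def center_def)
qed

lemma subgroup_centralizer_center:
  assumes "x \<in> carrier G"
  shows "subgroup (centralizer_center G x) G"
  unfolding centralizer_center_def
  by (rule incl_subgroup[OF subgroup_centralizer[OF assms]
        group.subgroup_center[OF subgroup_imp_group[OF subgroup_centralizer[OF assms]]]])

lemma center_subset_centralizer_center:
  assumes "x \<in> carrier G"
  shows "center G \<subseteq> centralizer_center G x"
  using subgroup.subset[OF subgroup_centralizer[OF assms]]
  unfolding centralizer_center_eq[OF assms] by (auto simp: mem_center_iff)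

lemma self_mem_centralizer_center:
  assumes "x \<in> carrier G"
  shows "x \<in> centralizer_center G x"
  using assms by (simp add: centralizer_center_eq)

text \<open>The F-property says that an inclusion of noncentral centralizers is an equality, so $Z(x)$
  consists of the center and the elements with the same centralizer as $x$. Hence the sets
  $Z(x) \setminus Z(G)$ partition the noncentral elements.\<close>

lemma centralizer_center_diff_center:
  assumes "F_group G" and x: "x \<in> carrier G - center G"
  shows "centralizer_center G x - center G = {y \<in> carrier G. centralizer G y = centralizer G x}"
proof -
  have "y \<notin> center G" if "centralizer G y = centralizer G x" for y
    using that x by (metis DiffE mem_center_iff)
  moreover have "centralizer G y = centralizer G x"
    if "y \<in> carrier G - center G" "centralizer G x \<subseteq> centralizer G y" for y
    using that x assms(1) unfolding F_group_def by blast
  ultimately show ?thesis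
    using x by (simp only: centralizer_center_eq[of x] DiffD1) blast
qed

text \<open>Conjugating a centralizer gives the centralizer of the conjugate, so $x$ and $y$ are in the same
  $z$-class iff some conjugate of $y$ has the same centralizer as $x$.\<close>

lemma conj_centralizer:
  assumes g: "g \<in> carrier G" and y: "y \<in> carrier G"
  shows "(g <# centralizer G y) #> inv g = centralizer G (g \<otimes> y \<otimes> inv g)"
proof -
  have fwd: "h \<otimes> c \<otimes> inv h \<in> centralizer G (h \<otimes> w \<otimes> inv h)"
    if h: "h \<in> carrier G" and w: "w \<in> carrier G" and c: "c \<in> centralizer G w" for h c w
  proof -
    have c': "c \<in> carrier G" "c \<otimes> w = w \<otimes> c" using c by (auto simp: centralizer_def)
    have "(h \<otimes> a \<otimes> inv h) \<otimes> (h \<otimes> b \<otimes> inv h) = h \<otimes> (a \<otimes> b) \<otimes> inv h"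
      if "a \<in> carrier G" "b \<in> carrier G" for a b
      using that h by (simp add: m_assoc cancel_inv)
    from this[of c w] this[of w c] show ?thesis using c' h w by (simp add: centralizer_def)
  qed
  show ?thesis
  proof (rule equalityI)
    show "(g <# centralizer G y) #> inv g \<subseteq> centralizer G (g \<otimes> y \<otimes> inv g)"
      using fwd[OF g y] by (auto simp: l_coset_def r_coset_def)
    show "centralizer G (g \<otimes> y \<otimes> inv g) \<subseteq> (g <# centralizer G y) #> inv g"
    proof
      fix d assume d: "d \<in> centralizer G (g \<otimes> y \<otimes> inv g)"
      then have dc: "d \<in> carrier G" by (simp add: centralizer_def)
      have "inv g \<otimes> (g \<otimes> y \<otimes> inv g) \<otimes> inv (inv g) = y"
        using g y by (simp add: m_assoc cancel_inv)
      then have "inv g \<otimes> d \<otimes> g \<in> centralizer G y"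
        using fwd[OF inv_closed[OF g] _ d] g y by simp
      moreover have "d = g \<otimes> (inv g \<otimes> d \<otimes> g) \<otimes> inv g"
        using g dc by (simp add: m_assoc cancel_inv)
      ultimately show "d \<in> (g <# centralizer G y) #> inv g"
        unfolding l_coset_def r_coset_def by blast
    qed
  qed
qed

lemma z_rel_iff:
  "(x, y) \<in> z_rel G \<longleftrightarrow> x \<in> carrier G \<and> y \<in> carrier G \<and>
     (\<exists>g \<in> carrier G. centralizer G x = centralizer G (g \<otimes> y \<otimes> inv g))"
  unfolding z_rel_def using conj_centralizer by auto

lemma z_class_of_central:
  assumes z: "z \<in> center G"
  shows "z_rel G `` {z} = center G"
proof -
  have zc: "z \<in> carrier G" and Cz: "centralizer G z = carrier G" using z by (auto simp: mem_center_iff)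
  have "y \<in> center G" if "(z, y) \<in> z_rel G" for y
  proof -
    have "(y, z) \<in> z_rel G" using that equiv_z_rel by (meson equivE symD)
    then obtain g where y: "y \<in> carrier G" and g: "g \<in> carrier G"
      and eq: "centralizer G y = centralizer G (g \<otimes> z \<otimes> inv g)"
      by (auto simp: z_rel_iff)
    have "g \<otimes> z = z \<otimes> g" using center_comm[OF z g] by (rule sym)
    then have "g \<otimes> z \<otimes> inv g = z" using g zc by (simp add: m_assoc)
    then show ?thesis using y eq Cz by (simp add: mem_center_iff)
  qed
  moreover have "(z, y) \<in> z_rel G" if "y \<in> center G" for y
    using that zc Cz by (auto simp: z_rel_iff mem_center_iff intro!: bexI[of _ \<one>])
  ultimately show ?thesis by auto
qed

section \<open>Subgroups above the center\<close>

text \<open>The index of $Z(G)$ in an intermediate subgroup divides $p^k$, so it is at least $p$ as soon as it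
  is not $1$.\<close>

lemma prime_mult_card_center_le:
  assumes fin: "finite (carrier G)" and p: "prime p" and ord: "order G = p ^ k * card (center G)"
    and H: "subgroup H G" and sub: "center G \<subset> H"
  shows "p * card (center G) \<le> card H"
proof -
  have finH: "finite H" using fin H by (meson finite_subset subgroup.subset)
  have N: "card (center G) > 0"
    using finite_subset[OF center_subset fin] subgroup.one_closed[OF subgroup_center]
    by (auto simp: card_gt_0_iff)
  have "subgroup (center G) (G\<lparr>carrier := H\<rparr>)"
    using subgroup_incl[OF subgroup_center H] sub by auto
  from group.lagrange[OF subgroup_imp_group[OF H] this]
  obtain t where t: "card H = card (center G) * t"
    by (simp add: order_def) (metis mult.commute)
  have "card (center G) * t dvd card (center G) * p ^ k"
    using lagrange[OF H] ord t by (metis dvd_triv_right mult.commute)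
  then have "t dvd p ^ k" using N by simp
  then obtain j where j: "t = p ^ j" using p by (auto simp: divides_primepow_nat)
  have "card (center G) < card H" using finH sub by (rule psubset_card_mono)
  then have "t \<noteq> 1" using t by auto
  then have "0 < j" using j by (auto intro: gr0I)
  then have "p \<le> t" unfolding j using prime_gt_0_nat[OF p] by (simp add: self_le_power)
  then show ?thesis using t by simp
qed

text \<open>Every element of $\langle x, Z(G)\rangle$ is $z x^i$ with $z$ central; if $x^n$ is central,
  then $i$ can be taken below $n$.\<close>

lemma card_generate_insert_center_le:
  assumes fin: "finite (carrier G)" and x: "x \<in> carrier G"
    and n: "0 < n" "x [^] (n::nat) \<in> center G"
  shows "card (generate G ({x} \<union> center G)) \<le> n * card (center G)"
proof -
  let ?Z = "center G"
  interpret Z: subgroup ?Z G by (rule subgroup_center)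
  have form: "\<exists>z\<in>?Z. \<exists>i::nat. y = z \<otimes> x [^] i" if "y \<in> generate G ({x} \<union> ?Z)" for y
    using that
  proof induction
    case one
    show ?case by (rule bexI[of _ \<one>], rule exI[of _ 0]) auto
  next
    case (incl h)
    then show ?case
    proof
      assume "h \<in> {x}"
      then show ?case using x by (intro bexI[of _ \<one>] exI[of _ 1]) auto
    next
      assume "h \<in> ?Z"
      then show ?case by (intro bexI[of _ h] exI[of _ 0]) auto
    qed
  next
    case (inv h)
    then show ?case
    proof
      assume "h \<in> {x}"
      have "x [^] (n - 1) \<otimes> x = x [^] n" using n(1) by (metis Suc_diff_1 nat_pow_Suc)
      then have "inv (x [^] n) \<otimes> x [^] (n - 1) \<otimes> x = \<one>" using x by (simp add: m_assoc)
      then have "inv x = inv (x [^] n) \<otimes> x [^] (n - 1)"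
        by (rule inv_equality) (use x in auto)
      then show ?case using \<open>h \<in> {x}\<close> n(2) by blast
    next
      assume "h \<in> ?Z"
      then show ?case by (intro bexI[of _ "inv h"] exI[of _ 0]) auto
    qed
  next
    case (eng h1 h2)
    then obtain z1 z2 and i j :: nat where z: "z1 \<in> ?Z" "z2 \<in> ?Z"
      and h: "h1 = z1 \<otimes> x [^] i" "h2 = z2 \<otimes> x [^] j" by blast
    have "h1 \<otimes> h2 = z1 \<otimes> (x [^] i \<otimes> z2) \<otimes> x [^] j" using z x h by (simp add: m_assoc)
    also have "x [^] i \<otimes> z2 = z2 \<otimes> x [^] i" using center_comm[OF z(2)] x by simp
    also have "z1 \<otimes> (z2 \<otimes> x [^] i) \<otimes> x [^] j = (z1 \<otimes> z2) \<otimes> x [^] (i + j)"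
      using z x by (simp add: nat_pow_mult[symmetric] m_assoc)
    finally show ?case using z by blast
  qed
  have "generate G ({x} \<union> ?Z) \<subseteq> (\<lambda>(i, z). z \<otimes> x [^] i) ` ({..<n} \<times> ?Z)"
  proof
    fix y assume "y \<in> generate G ({x} \<union> ?Z)"
    then obtain z and i :: nat where z: "z \<in> ?Z" and y: "y = z \<otimes> x [^] i" using form by blast
    have "x [^] i = (x [^] n) [^] (i div n) \<otimes> x [^] (i mod n)"
      using x by (simp add: nat_pow_pow nat_pow_mult)
    then have y': "y = (z \<otimes> (x [^] n) [^] (i div n)) \<otimes> x [^] (i mod n)"
      using y x z by (simp add: m_assoc)
    have "(x [^] n) [^] (j::nat) \<in> ?Z" for j by (induction j) (use n(2) in auto)
    then have "(i mod n, z \<otimes> (x [^] n) [^] (i div n)) \<in> {..<n} \<times> ?Z" using z n(1) by simp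
    then show "y \<in> (\<lambda>(i, z). z \<otimes> x [^] i) ` ({..<n} \<times> ?Z)" using y' by force
  qed
  moreover have "finite ?Z" using fin center_subset by (rule rev_finite_subset)
  ultimately have "card (generate G ({x} \<union> ?Z)) \<le> card ({..<n} \<times> ?Z)"
    by (intro surj_card_le) auto
  then show ?thesis by (simp only: card_cartesian_product card_lessThan)
qed

text \<open>This is the fact that the order of an element divides the group order, for the group $A/Z(G)$.\<close>

lemma pow_index_mem_center:
  assumes fin: "finite (carrier G)" and A: "subgroup A G" and sub: "center G \<subseteq> A"
    and card: "card A = n * card (center G)" and x: "x \<in> A"
  shows "x [^] n \<in> center G"
proof -
  let ?A = "G\<lparr>carrier := A\<rparr>" and ?Z = "center G"
  interpret A: group ?A using A by (rule subgroup_imp_group)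
  have ZA: "subgroup ?Z ?A" using subgroup_incl[OF subgroup_center A sub] .
  have "?Z \<lhd> ?A"
  proof (rule A.normalI[OF ZA], rule ballI)
    fix a assume "a \<in> carrier ?A"
    then have "a \<in> carrier G" using subgroup.subset[OF A] by auto
    then have "h \<otimes> a = a \<otimes> h" if "h \<in> ?Z" for h using that by (rule center_comm[rotated])
    then show "?Z #>\<^bsub>?A\<^esub> a = a <#\<^bsub>?A\<^esub> ?Z"
      unfolding r_coset_def l_coset_def by simp
  qed
  then interpret N: normal ?Z ?A .
  have "card (?Z) > 0"
    using finite_subset[OF center_subset fin] subgroup.one_closed[OF subgroup_center]
    by (auto simp: card_gt_0_iff)
  moreover have "card (rcosets\<^bsub>?A\<^esub> ?Z) * card ?Z = n * card ?Z"
    using A.lagrange[OF ZA] card by (simp add: order_def)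
  ultimately have n: "order (?A Mod ?Z) = n" by (simp add: order_def FactGroup_def)
  have "?Z #>\<^bsub>?A\<^esub> x \<in> carrier (?A Mod ?Z)" using x by (auto simp: carrier_FactGroup)
  from group.pow_order_eq_1[OF N.factorgroup_is_group this]
  have "?Z #>\<^bsub>?A\<^esub> (x [^]\<^bsub>?A\<^esub> n) = ?Z"
    using N.FactGroup_pow[of x n] x unfolding n one_FactGroup by simp
  then have "x [^]\<^bsub>?A\<^esub> n \<in> ?Z" using A.coset_join1[OF _ _ ZA] A.nat_pow_closed x by simp
  then show ?thesis by (simp add: nat_pow_consistent[symmetric])
qed

section \<open>The number of z-classes\<close>

lemma centralizer_fibre_subset_z_class:
  assumes "x \<in> carrier G"
  shows "{y \<in> carrier G. centralizer G y = centralizer G x} \<subseteq> z_rel G `` {x}"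
  using assms by (auto simp: z_rel_iff intro!: bexI[of _ \<one>])

lemma z_class_subset: "z_rel G `` {x} \<subseteq> carrier G"
  by (auto simp: z_rel_def)

lemma card_centralizer_center_diff:
  assumes fin: "finite (carrier G)" and x: "x \<in> carrier G"
  shows "card (centralizer_center G x - center G) = card (centralizer_center G x) - card (center G)"
  using center_subset_centralizer_center[OF x] finite_subset[OF center_subset fin]
  by (simp add: card_Diff_subset)

lemma le_card_centralizer_center:
  assumes fin: "finite (carrier G)" and p: "prime p" and ord: "order G = p ^ k * card (center G)"
    and x: "x \<in> carrier G - center G"
  shows "p * card (center G) \<le> card (centralizer_center G x)"
  using x center_subset_centralizer_center self_mem_centralizer_center subgroup_centralizer_center
  by (intro prime_mult_card_center_le[OF fin p ord]) auto

text \<open>The class count is maximal iff the classes are as small as possible: the noncentral $z$-classes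
  partition $(p^k-1) |Z(G)|$ elements, and each contains a set $Z(x) \setminus Z(G)$ with at least
  $(p-1) |Z(G)|$ elements.\<close>

lemma card_z_classes_eq_iff:
  assumes F: "F_group G" and p: "prime p" and ord: "order G = p ^ k * card (center G)"
  shows "card (z_classes G) = (p ^ k - 1) div (p - 1) + 1 \<longleftrightarrow>
    (\<forall>x \<in> carrier G - center G. card (z_rel G `` {x}) = (p - 1) * card (center G))"
proof -
  let ?Z = "center G" and ?b = "(p - 1) * card (center G)"
  let ?P = "z_classes G - {center G}"
  have fin: "finite (carrier G)" using F by (simp add: F_group_def)
  have finZ: "finite ?Z" using fin center_subset by (rule rev_finite_subset)
  have one: "\<one> \<in> ?Z" using subgroup_center by (rule subgroup.one_closed)
  have Zclass: "?Z \<in> z_classes G"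
    unfolding z_classes_def z_class_of_central[OF one, symmetric] by (rule quotientI) simp
  have disj: "pairwise disjnt (z_classes G)"
    using quotient_disj[OF equiv_z_rel] by (auto simp: z_classes_def pairwise_def disjnt_def)
  have Un: "\<Union>(z_classes G) = carrier G"
    unfolding z_classes_def by (rule Union_quotient[OF equiv_z_rel])
  have finzc: "finite (z_classes G)" using fin Un by (metis finite_UnionD)
  have P_eq: "?P = (\<lambda>x. z_rel G `` {x}) ` (carrier G - ?Z)"
  proof (intro equalityI subsetI)
    fix S assume "S \<in> ?P"
    then have "S \<in> carrier G // z_rel G" and "S \<noteq> ?Z" by (simp_all add: z_classes_def)
    then obtain x where "x \<in> carrier G" "S = z_rel G `` {x}" by (elim quotientE)
    with \<open>S \<noteq> ?Z\<close> have "x \<in> carrier G - ?Z" and "S = z_rel G `` {x}" using z_class_of_central by auto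
    then show "S \<in> (\<lambda>x. z_rel G `` {x}) ` (carrier G - ?Z)" by blast
  next
    fix S assume "S \<in> (\<lambda>x. z_rel G `` {x}) ` (carrier G - ?Z)"
    then obtain x where x: "x \<in> carrier G - ?Z" "S = z_rel G `` {x}" by blast
    then have "x \<in> S" using equiv_class_self[OF equiv_z_rel] by blast
    then have "S \<noteq> ?Z" using x(1) by blast
    then show "S \<in> ?P" using x by (simp add: z_classes_def quotientI)
  qed
  have UnP: "\<Union>?P = carrier G - ?Z"
    using disj Zclass Un by (fastforce simp: pairwise_def disjnt_def)
  have dvd: "(p - 1) dvd (p ^ k - 1)"
  proof -
    have "int p ^ k - 1 = (int p - 1) * (\<Sum>i<k. int p ^ i)" by (rule power_diff_1_eq)
    then have "int (p - 1) dvd int (p ^ k - 1)"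
      using p by (simp add: of_nat_diff prime_gt_0_nat Suc_leI)
    then show ?thesis by (simp only: int_dvd_int_iff)
  qed
  have "card ?P = (p ^ k - 1) div (p - 1) \<longleftrightarrow> (\<forall>S\<in>?P. card S = ?b)"
  proof (rule card_eq_iff_blocks_minimal)
    show "pairwise disjnt ?P" using disj by (rule pairwise_subset) blast
    show "finite (\<Union>?P)" using UnP fin by simp
    show "0 < ?b" using prime_gt_1_nat[OF p] finZ one by (auto simp: card_gt_0_iff)
    have "card (carrier G - ?Z) = p ^ k * card ?Z - card ?Z"
      using ord finZ center_subset by (simp add: card_Diff_subset order_def)
    also have "\<dots> = (p ^ k - 1) * card ?Z" by (simp add: diff_mult_distrib)
    also have "\<dots> = ((p - 1) * ((p ^ k - 1) div (p - 1))) * card ?Z"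
      using dvd by (simp only: dvd_mult_div_cancel)
    finally show "card (\<Union>?P) = ?b * ((p ^ k - 1) div (p - 1))" by (simp add: UnP ac_simps)
  next
    fix S assume "S \<in> ?P"
    then obtain x where x: "x \<in> carrier G - ?Z" and S: "S = z_rel G `` {x}" unfolding P_eq by blast
    have "?b \<le> card (centralizer_center G x - ?Z)"
      using le_card_centralizer_center[OF fin p ord x] card_centralizer_center_diff[OF fin] x
      by (simp add: diff_mult_distrib diff_le_mono)
    also have "\<dots> \<le> card S"
      unfolding S centralizer_center_diff_center[OF F x]
      using x centralizer_fibre_subset_z_class finite_subset[OF z_class_subset fin]
      by (intro card_mono) auto
    finally show "?b \<le> card S" .
  qed
  moreover have "card (z_classes G) = card ?P + 1"
    using card.remove[OF finzc Zclass] by simp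
  ultimately show ?thesis by (auto simp: P_eq)
qed

section \<open>The two implications\<close>

text \<open>The $z$-class of $x$ contains $Z(x) \setminus Z(G)$, which already has $(p-1)|Z(G)|$ elements, so a
  class of that size leaves no choice.\<close>

lemma z_class_eq_of_minimal:
  assumes F: "F_group G" and p: "prime p" and ord: "order G = p ^ k * card (center G)"
    and x: "x \<in> carrier G - center G"
    and card: "card (z_rel G `` {x}) = (p - 1) * card (center G)"
  shows "z_rel G `` {x} = centralizer_center G x - center G"
    and "card (centralizer_center G x) = p * card (center G)"
proof -
  have fin: "finite (carrier G)" using F by (simp add: F_group_def)
  have xc: "x \<in> carrier G" using x by simp
  have sub: "centralizer_center G x - center G \<subseteq> z_rel G `` {x}"
    unfolding centralizer_center_diff_center[OF F x] by (rule centralizer_fibre_subset_z_class[OF xc])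
  have finz: "finite (z_rel G `` {x})" using z_class_subset fin by (rule finite_subset)
  note le = le_card_centralizer_center[OF fin p ord x]
  note diff = card_centralizer_center_diff[OF fin xc]
  have "card (centralizer_center G x) - card (center G) \<le> (p - 1) * card (center G)"
    using card_mono[OF finz sub] diff card by simp
  moreover have "(p - 1) * card (center G) + card (center G) = p * card (center G)"
    using prime_gt_0_nat[OF p] by (metis Suc_diff_1 add.commute mult_Suc)
  ultimately show c: "card (centralizer_center G x) = p * card (center G)" using le by linarith
  show "z_rel G `` {x} = centralizer_center G x - center G"
    by (rule sym, rule card_subset_eq[OF finz sub]) (simp add: diff c card diff_mult_distrib)
qed

lemma comm_group_factor_center:
  assumes comm: "\<And>x y. x \<in> carrier G \<Longrightarrow> y \<in> carrier G \<Longrightarrow> x \<otimes> y \<otimes> inv x \<otimes> inv y \<in> center G"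
  shows "comm_group (G Mod center G)"
proof -
  interpret N: normal "center G" G by (rule normal_center)
  show ?thesis
  proof (rule group.group_comm_groupI[OF N.factorgroup_is_group])
    fix X Y assume "X \<in> carrier (G Mod center G)" "Y \<in> carrier (G Mod center G)"
    then obtain x y where xy: "x \<in> carrier G" "y \<in> carrier G"
      and XY: "X = center G #> x" "Y = center G #> y" by (auto simp: carrier_FactGroup)
    have "(x \<otimes> y \<otimes> inv x \<otimes> inv y) \<otimes> (y \<otimes> x) = x \<otimes> y"
      using xy by (simp add: m_assoc cancel_inv)
    then have "x \<otimes> y \<in> center G #> (y \<otimes> x)"
      using comm[OF xy] unfolding r_coset_def by force
    then have "center G #> (x \<otimes> y) = center G #> (y \<otimes> x)"
      using repr_independence[OF _ _ subgroup_center] xy by (metis m_closed)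
    then show "X \<otimes>\<^bsub>G Mod center G\<^esub> Y = Y \<otimes>\<^bsub>G Mod center G\<^esub> X"
      using xy XY by (simp add: N.rcos_sum)
  qed
qed

text \<open>Since the $z$-class of $x$ contains the conjugates of $x$, minimality puts them into $Z(x)$. A
  commutator of $x$ and $y$ is both $x$ times a conjugate of $x^{-1}$ and a conjugate of $y$ times
  $y^{-1}$, so it lies in $Z(x) \cap Z(y)$. A noncentral element there would force $C(x) = C(y)$.\<close>

lemma elementary_abelian_if_z_classes_minimal:
  assumes F: "F_group G" and p: "prime p" and ord: "order G = p ^ k * card (center G)"
    and min: "\<And>x. x \<in> carrier G - center G \<Longrightarrow> card (z_rel G `` {x}) = (p - 1) * card (center G)"
  shows "elementary_abelian (G Mod center G)"
proof -
  let ?Z = "center G"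
  interpret N: normal ?Z G by (rule normal_center)
  interpret Q: group "G Mod ?Z" by (rule N.factorgroup_is_group)
  have fin: "finite (carrier G)" using F by (simp add: F_group_def)
  note zclass = z_class_eq_of_minimal[OF F p ord _ min]
  have conj: "g \<otimes> x \<otimes> inv g \<in> centralizer_center G x"
    if "x \<in> carrier G - ?Z" "g \<in> carrier G" for x g
  proof -
    have "(g \<otimes> x \<otimes> inv g, x) \<in> z_rel G" using that by (auto simp: z_rel_iff)
    then have "g \<otimes> x \<otimes> inv g \<in> z_rel G `` {x}" using equiv_z_rel by (auto elim: equivE dest: symD)
    then show ?thesis using zclass(1)[OF that(1) that(1)] by blast
  qed
  have "x \<otimes> y \<otimes> inv x \<otimes> inv y \<in> ?Z" if xy: "x \<in> carrier G" "y \<in> carrier G" for x y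
  proof (cases "x \<in> ?Z \<or> y \<in> ?Z \<or> centralizer G x = centralizer G y")
    case True
    moreover have "y \<in> centralizer G y" using xy by (simp add: centralizer_def)
    ultimately have "x \<otimes> y = y \<otimes> x"
      using xy unfolding center_def centralizer_def by fastforce
    then have "x \<otimes> y \<otimes> inv x \<otimes> inv y = \<one>" using xy by (simp add: m_assoc cancel_inv)
    then show ?thesis by simp
  next
    case False
    then have nc: "x \<in> carrier G - ?Z" "y \<in> carrier G - ?Z" using xy by auto
    have sx: "subgroup (centralizer_center G x) G" and sy: "subgroup (centralizer_center G y) G"
      using xy by (auto intro: subgroup_centralizer_center)
    let ?c = "x \<otimes> y \<otimes> inv x \<otimes> inv y"
    \<comment> \<open>Bracketed as $x \cdot (y x y^{-1})^{-1}$.\<close>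
    have "x \<otimes> (y \<otimes> inv x \<otimes> inv y) \<in> centralizer_center G x"
    proof -
      have "inv (y \<otimes> x \<otimes> inv y) \<in> centralizer_center G x"
        using conj[OF nc(1) xy(2)] sx by (metis subgroup.m_inv_closed)
      moreover have "inv (y \<otimes> x \<otimes> inv y) = y \<otimes> inv x \<otimes> inv y"
        using xy by (simp add: inv_mult_group m_assoc)
      ultimately show ?thesis
        using sx self_mem_centralizer_center[OF xy(1)] by (metis subgroup.m_closed)
    qed
    then have cx: "?c \<in> centralizer_center G x" using xy by (simp add: m_assoc)
    have cy: "?c \<in> centralizer_center G y"
      using conj[OF nc(2) xy(1)] sy self_mem_centralizer_center[OF xy(2)]
      by (metis subgroup.m_closed subgroup.m_inv_closed)
    show ?thesis
    proof (rule ccontr)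
      assume "?c \<notin> ?Z"
      then have "centralizer G ?c = centralizer G x" "centralizer G ?c = centralizer G y"
        using cx cy centralizer_center_diff_center[OF F nc(1)]
          centralizer_center_diff_center[OF F nc(2)] by blast+
      then show False using False by simp
    qed
  qed
  then have "comm_group (G Mod ?Z)" by (rule comm_group_factor_center)
  moreover have "Q.ord X = p" if X: "X \<in> carrier (G Mod ?Z) - {\<one>\<^bsub>G Mod ?Z\<^esub>}" for X
  proof -
    obtain x where x: "x \<in> carrier G" "X = ?Z #> x" using X by (auto simp: carrier_FactGroup)
    have nc: "x \<in> carrier G - ?Z" using X x coset_join2[OF _ subgroup_center] by auto
    have "x [^] p \<in> ?Z"
      using pow_index_mem_center[OF fin subgroup_centralizer_center
          center_subset_centralizer_center zclass(2)[OF nc nc] self_mem_centralizer_center] x by blast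
    then have "X [^]\<^bsub>G Mod ?Z\<^esub> p = \<one>\<^bsub>G Mod ?Z\<^esub>"
      using x coset_join2[OF _ subgroup_center] by (simp add: N.FactGroup_pow)
    then have "Q.ord X dvd p" using X Q.pow_eq_id by blast
    moreover have "Q.ord X \<noteq> 1" using X Q.ord_eq_1 by auto
    ultimately show ?thesis using p by (metis prime_nat_iff)
  qed
  ultimately show ?thesis using p unfolding elementary_abelian_def by blast
qed

text \<open>The subgroup $\langle x, Z(G)\rangle$ lies between $Z(G)$ and $Z(x)$ and differs from $Z(G)$, so its
  order is at least $p |Z(G)| = |Z(x)|$.\<close>

lemma centralizer_center_eq_generate_if_minimal:
  assumes fin: "finite (carrier G)" and p: "prime p" and ord: "order G = p ^ k * card (center G)"
    and x: "x \<in> carrier G - center G"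
    and card: "card (centralizer_center G x) = p * card (center G)"
  shows "centralizer_center G x = generate G ({x} \<union> center G)"
proof -
  let ?H = "generate G ({x} \<union> center G)"
  have xc: "x \<in> carrier G" using x by simp
  have H: "subgroup ?H G" using xc center_subset by (intro generate_is_subgroup) auto
  have "{x} \<union> center G \<subseteq> ?H" by (auto intro: generate.incl)
  then have "center G \<subset> ?H" using x by blast
  then have "p * card (center G) \<le> card ?H" by (rule prime_mult_card_center_le[OF fin p ord H])
  moreover have "?H \<subseteq> centralizer_center G x"
    using self_mem_centralizer_center[OF xc] center_subset_centralizer_center[OF xc]
    by (intro generate_subgroup_incl subgroup_centralizer_center[OF xc]) auto
  moreover have "finite (centralizer_center G x)"
    using fin subgroup.subset[OF subgroup_centralizer_center[OF xc]] by (rule rev_finite_subset)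
  ultimately show ?thesis using card by (metis card_seteq)
qed

text \<open>When $G/Z(G)$ is abelian, a conjugate $g y g^{-1}$ is $z y$ with $z$ central, and a central
  factor does not change the centralizer. So conjugacy of centralizers is the same as equality, and the
  $z$-class of $x$ is $Z(x) \setminus Z(G)$. The exponent of $G/Z(G)$ can only be $p$, as it divides
  $p^k$, and this bounds the order of $Z(x) = \langle x, Z(G)\rangle$.\<close>

lemma z_class_minimal_if_elementary_abelian:
  assumes F: "F_group G" and p: "prime p" and ord: "order G = p ^ k * card (center G)"
    and Q: "order (G Mod center G) = p ^ k"
    and ea: "elementary_abelian (G Mod center G)"
    and x: "x \<in> carrier G - center G"
    and gen: "centralizer_center G x = generate G ({x} \<union> center G)"
  shows "card (z_rel G `` {x}) = (p - 1) * card (center G)"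
proof -
  let ?Z = "center G"
  interpret N: normal ?Z G by (rule normal_center)
  interpret Q: comm_group "G Mod ?Z" using ea by (simp add: elementary_abelian_def)
  have fin: "finite (carrier G)" using F by (simp add: F_group_def)
  have xc: "x \<in> carrier G" using x by simp
  let ?X = "?Z #> x"
  have X: "?X \<in> carrier (G Mod ?Z)" using xc by (auto simp: carrier_FactGroup)
  have "?X \<noteq> \<one>\<^bsub>G Mod ?Z\<^esub>" using x coset_join1[OF _ xc subgroup_center] by auto
  then obtain q where q: "prime q" "Q.ord ?X = q"
    using ea X unfolding elementary_abelian_def by blast
  have "q dvd p ^ k" using Q.ord_dvd_group_order[OF X] q Q by simp
  then have "q = p" using p q by (metis prime_dvd_power primes_dvd_imp_eq)
  then have "?X [^]\<^bsub>G Mod ?Z\<^esub> p = \<one>\<^bsub>G Mod ?Z\<^esub>" using Q.pow_ord_eq_1[OF X] q by simp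
  then have "?Z #> (x [^] p) = ?Z" using xc by (simp add: N.FactGroup_pow)
  then have "x [^] p \<in> ?Z" using coset_join1[OF _ _ subgroup_center] xc by simp
  then have "card (centralizer_center G x) \<le> p * card ?Z"
    unfolding gen by (rule card_generate_insert_center_le[OF fin xc prime_gt_0_nat[OF p]])
  then have card: "card (centralizer_center G x) = p * card ?Z"
    using le_card_centralizer_center[OF fin p ord x] by simp
  have conj: "centralizer G (g \<otimes> y \<otimes> inv g) = centralizer G y"
    if "g \<in> carrier G" "y \<in> carrier G" for g y
  proof -
    have "(?Z #> g) \<otimes>\<^bsub>G Mod ?Z\<^esub> (?Z #> y) = (?Z #> y) \<otimes>\<^bsub>G Mod ?Z\<^esub> (?Z #> g)"
      using that by (intro Q.m_comm) (auto simp: carrier_FactGroup)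
    then have "?Z #> (y \<otimes> g) = ?Z #> (g \<otimes> y)" using that by (simp add: N.rcos_sum)
    then have "g \<otimes> y \<in> ?Z #> (y \<otimes> g)"
      using that by (intro repr_independenceD[OF subgroup_center]) auto
    then obtain z where z: "z \<in> ?Z" and eq: "g \<otimes> y = z \<otimes> (y \<otimes> g)" by (auto simp: r_coset_def)
    have zc: "z \<in> carrier G" using z center_subset by blast
    have zcomm: "a \<otimes> z = z \<otimes> a" if "a \<in> carrier G" for a
      using center_comm[OF z that] by (rule sym)
    have "g \<otimes> y \<otimes> inv g = z \<otimes> y" using that zc eq by (simp add: m_assoc)
    moreover have "centralizer G (z \<otimes> y) = centralizer G y"
    proof -
      have "a \<otimes> (z \<otimes> y) = z \<otimes> (a \<otimes> y)" if "a \<in> carrier G" for a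
        using that \<open>y \<in> carrier G\<close> zc zcomm by (metis m_assoc)
      then show ?thesis using that zc by (auto simp: centralizer_def m_assoc)
    qed
    ultimately show ?thesis by simp
  qed
  have "z_rel G `` {x} = {y \<in> carrier G. centralizer G y = centralizer G x}"
    using xc conj by (auto simp: z_rel_iff)
  then have "z_rel G `` {x} = centralizer_center G x - ?Z"
    by (simp add: centralizer_center_diff_center[OF F x])
  then show ?thesis
    using card card_centralizer_center_diff[OF fin xc] by (simp add: diff_mult_distrib)
qed

end

theorem theorem3p23:
  fixes G :: "('a, 'b) monoid_scheme" and p k :: nat
  assumes "F_group G"
    and "prime p"
    and "order (G Mod center G) = p ^ k"
  shows "card (z_classes G) = (p ^ k - 1) div (p - 1) + 1 \<longleftrightarrow>
    elementary_abelian (G Mod center G) \<and>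
    (\<forall>x \<in> carrier G - center G. centralizer_center G x = generate G ({x} \<union> center G))"
proof -
  interpret group G using assms(1) by (simp add: F_group_def)
  have fin: "finite (carrier G)" using assms(1) by (simp add: F_group_def)
  have ord: "order G = p ^ k * card (center G)"
    using lagrange[OF subgroup_center] assms(3) by (simp add: order_def FactGroup_def)
  note pre = assms(1,2) ord
  show ?thesis
    unfolding card_z_classes_eq_iff[OF pre]
    using elementary_abelian_if_z_classes_minimal[OF pre]
      centralizer_center_eq_generate_if_minimal[OF fin assms(2) ord]
      z_class_eq_of_minimal(2)[OF pre] z_class_minimal_if_elementary_abelian[OF pre assms(3)]
    by blast
qed

end
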